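(* Let $a,r,h,g$ be positive integers with $ga+h<gr$, and put $n=rg$. Then there exists an MR $(n,r,h,a)$-LRC over a field of size \[\ell\le\left(\max\left\{\tilde O\!\left(\tfrac nr\right),\ (2r)^{r}\right\}\right)^{\min\{h,\frac nr\}}.\]
   Context: $\tilde O(f)$ denotes $f\cdot(\log f)^{O(1)}$. Definition: let $\ell$ be a prime power, $a,g,r,h$ positive integers with $ga+h<gr$, $n=gr$, $k=n-ga-h$. An MR (maximally recoverable) $(n,r,h,a)_\ell$-LRC is an $[n,k]$ linear code over $\mathbb{F}_\ell$ with a parity-check matrix $H$ of the block form whose first $ga$ rows are block diagonal with diagonal blocks $A_1,\dots,A_g$ (each $a\times r$, coordinates split into $g$ consecutive groups of size $r$) and whose last $h$ rows are $(D_1|\cdots|D_g)$ with each $D_i$ of size $h\times r$, such that (i) each $A_i$ generates an $[r,a,r-a+1]_\ell$ MDS code, and (ii) every set of $ag+h$ columns of $H$ consisting of any $a$ columns from each group together with any $h$ further columns is linearly independent over $\mathbb{F}_\ell$. "Over a field of size $\ell$" means an MR $(n,r,h,a)_\ell$-LRC. *)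

theory Defs
  imports "HOL-Algebra.Ring" "HOL-Algebra.QuotRing" Complex_Main
begin

text \<open>Matrices over a field F (HOL-Algebra) are represented as functions
  nat => nat => 'a, with row index first; only entries within the stated
  dimensions matter.\<close>

definition lin_indep_family :: "('a, 'b) ring_scheme \<Rightarrow> nat set \<Rightarrow> nat \<Rightarrow> (nat \<Rightarrow> nat \<Rightarrow> 'a) \<Rightarrow> bool" where
  "lin_indep_family F S m v \<longleftrightarrow>
     (\<forall>c. c \<in> S \<rightarrow> carrier F \<longrightarrow>
        (\<forall>i<m. finsum F (\<lambda>j. c j \<otimes>\<^bsub>F\<^esub> v j i) S = \<zero>\<^bsub>F\<^esub>) \<longrightarrow>
        (\<forall>j\<in>S. c j = \<zero>\<^bsub>F\<^esub>))"

definition row_comb :: "('a, 'b) ring_scheme \<Rightarrow> nat \<Rightarrow> (nat \<Rightarrow> nat \<Rightarrow> 'a) \<Rightarrow> (nat \<Rightarrow> 'a) \<Rightarrow> nat \<Rightarrow> 'a" where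
  "row_comb F a A c j = finsum F (\<lambda>i. c i \<otimes>\<^bsub>F\<^esub> A i j) {..<a}"

definition hweight :: "('a, 'b) ring_scheme \<Rightarrow> nat \<Rightarrow> (nat \<Rightarrow> 'a) \<Rightarrow> nat" where
  "hweight F r v = card {j. j < r \<and> v j \<noteq> \<zero>\<^bsub>F\<^esub>}"

definition generates_MDS :: "('a, 'b) ring_scheme \<Rightarrow> nat \<Rightarrow> nat \<Rightarrow> (nat \<Rightarrow> nat \<Rightarrow> 'a) \<Rightarrow> bool" where
  "generates_MDS F r a A \<longleftrightarrow>
     (\<forall>i<a. \<forall>j<r. A i j \<in> carrier F) \<and>
     lin_indep_family F {..<a} r A \<and>
     (\<forall>c. c \<in> {..<a} \<rightarrow> carrier F \<longrightarrow> (\<exists>j<r. row_comb F a A c j \<noteq> \<zero>\<^bsub>F\<^esub>) \<longrightarrow>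
          hweight F r (row_comb F a A c) \<ge> r - a + 1) \<and>
     (\<exists>c. c \<in> {..<a} \<rightarrow> carrier F \<and> (\<exists>j<r. row_comb F a A c j \<noteq> \<zero>\<^bsub>F\<^esub>) \<and>
          hweight F r (row_comb F a A c) = r - a + 1)"

text \<open>H is a parity-check matrix ((g*a+h) x (g*r)) of an MR (n,r,h,a)-LRC with n = g*r:
  rows i < g*a form the block-diagonal part (block k: rows k*a..k*a+a-1,
  columns k*r..k*r+r-1, zero outside the blocks), rows g*a..g*a+h-1 are the
  global part (D_1|...|D_g). Group k of coordinates is {k*r..<k*r+r}.\<close>
definition MR_LRC_parity :: "('a, 'b) ring_scheme \<Rightarrow> nat \<Rightarrow> nat \<Rightarrow> nat \<Rightarrow> nat \<Rightarrow> (nat \<Rightarrow> nat \<Rightarrow> 'a) \<Rightarrow> bool" where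
  "MR_LRC_parity F g r h a H \<longleftrightarrow>
     (\<forall>i < g*a + h. \<forall>j < g*r. H i j \<in> carrier F) \<and>
     (\<forall>i < g*a. \<forall>j < g*r. i div a \<noteq> j div r \<longrightarrow> H i j = \<zero>\<^bsub>F\<^esub>) \<and>
     (\<forall>k < g. generates_MDS F r a (\<lambda>i j. H (k*a + i) (k*r + j))) \<and>
     (\<forall>S. S \<subseteq> {..<g*r} \<longrightarrow> card S = g*a + h \<longrightarrow>
          (\<forall>k < g. card (S \<inter> {k*r..<k*r+r}) \<ge> a) \<longrightarrow>
          lin_indep_family F S (g*a + h) (\<lambda>j i. H i j))"

text \<open>There is an MR (n,r,h,a)-LRC over the finite field F (n = g*r).
  The code is the kernel of H; its dimension n-ga-h follows from condition (ii).\<close>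
definition has_MR_LRC :: "('a, 'b) ring_scheme \<Rightarrow> nat \<Rightarrow> nat \<Rightarrow> nat \<Rightarrow> nat \<Rightarrow> bool" where
  "has_MR_LRC F g r h a \<longleftrightarrow> (\<exists>H. MR_LRC_parity F g r h a H)"

end

theory Submission
  imports Defs "HOL-Algebra.Algebraic_Closure_Type" "HOL-Library.Z2"
begin

text \<open>
  Let \<open>q\<close> be the power of two with \<open>r \<le> q < 2r\<close>, let \<open>t = min h g\<close> and \<open>m \<ge> r\<close> be least with
  \<open>q\<^sup>m \<ge> g\<close>, and work in the tower \<open>GF(q) \<subseteq> GF(q\<^sup>m) \<subseteq> GF(q\<^sup>m\<^sup>t)\<close> inside an algebraic closure of
  \<open>GF(2)\<close>. All local blocks are the same Vandermonde matrix with nodes in \<open>GF(q)\<close>. The heavy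
  rows form a Moore matrix: column \<open>j\<close> of group \<open>k\<close> carries the \<open>q\<^sup>i\<close>-th powers of
  \<open>w\<^sub>j v\<^sub>k\<close>, where the \<open>w\<^sub>j\<close> in \<open>GF(q\<^sup>m)\<close> are independent over \<open>GF(q)\<close> and any \<open>t\<close> of the
  \<open>v\<^sub>k\<close> are independent over \<open>GF(q\<^sup>m)\<close>. Hence the elements \<open>w\<^sub>j v\<^sub>k\<close> belonging to any \<open>t\<close>
  groups are independent over \<open>GF(q)\<close>, and this is enough because \<open>h\<close> surplus columns meet at
  most \<open>t\<close> groups.
  If \<open>q\<^sup>r < g\<close>, then \<open>r\<close> is logarithmic in \<open>g\<close> and \<open>q\<^sup>m < q g \<le> 2 r g\<close>.
\<close>

section \<open>Finite subfields of an algebraically closed field as fixed sets of Frobenius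
  powers\<close>

text \<open>In an algebraically closed field, with \<open>q\<close> a positive power of the prime
  characteristic, this is GF(q).\<close>

definition frobenius_fixed :: "nat \<Rightarrow> 'a::field set" where
  "frobenius_fixed q = {x. x ^ q = x}"

text \<open>Subfields are subsets of one ambient type-class field, so that the whole tower lives in
  a single type and the type-class polynomials and sums apply to every level.\<close>

locale field_subset =
  fixes L :: "'a::field set"
  assumes zero_closed [simp, intro]: "0 \<in> L"
    and one_closed [simp, intro]: "1 \<in> L"
    and add_closed [intro]: "x \<in> L \<Longrightarrow> y \<in> L \<Longrightarrow> x + y \<in> L"
    and uminus_closed [intro]: "x \<in> L \<Longrightarrow> - x \<in> L"
    and mult_closed [intro]: "x \<in> L \<Longrightarrow> y \<in> L \<Longrightarrow> x * y \<in> L"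
    and inverse_closed [intro]: "x \<in> L \<Longrightarrow> inverse x \<in> L"
begin

lemma diff_closed [intro]: "x \<in> L \<Longrightarrow> y \<in> L \<Longrightarrow> x - y \<in> L"
  using add_closed[of x "- y"] by auto

lemma divide_closed [intro]: "x \<in> L \<Longrightarrow> y \<in> L \<Longrightarrow> x / y \<in> L"
  unfolding divide_inverse by auto

lemma power_closed [intro]: "x \<in> L \<Longrightarrow> x ^ n \<in> L"
  by (induction n) auto

lemma sum_closed [intro]: "(\<And>i. i \<in> A \<Longrightarrow> f i \<in> L) \<Longrightarrow> sum f A \<in> L"
  by (induction A rule: infinite_finite_induct) auto

end

lemma frobenius_add:
  fixes x y :: "'a::field"
  assumes "prime CHAR('a)" "q = CHAR('a) ^ e"
  shows "(x + y) ^ q = x ^ q + y ^ q"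
  using freshmans_dream'[of q e x y] assms by simp

lemma frobenius_sum:
  fixes f :: "'b \<Rightarrow> 'a::field"
  assumes "prime CHAR('a)" "q = CHAR('a) ^ e"
  shows "sum f A ^ q = (\<Sum>i\<in>A. f i ^ q)"
  using freshmans_dream_sum'[of q e f A] assms by simp

lemma field_subset_frobenius_fixed:
  assumes p: "prime CHAR('a)" "q = CHAR('a) ^ e"
  shows "field_subset (frobenius_fixed q :: 'a::field set)"
proof -
  have q0: "q > 0" using p by (simp add: prime_gt_0_nat)
  have um: "(- x) ^ q = - x" if "x ^ q = x" for x :: 'a
  proof -
    have "0 = (x + - x) ^ q" using q0 by simp
    also have "\<dots> = x ^ q + (- x) ^ q" by (rule frobenius_add[OF p])
    finally show ?thesis using that by (simp add: add_eq_0_iff)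
  qed
  show ?thesis
    using q0 um
    by unfold_locales
      (auto simp: frobenius_fixed_def frobenius_add[OF p] power_mult_distrib power_inverse)
qed

lemma frobenius_fixed_power: "x \<in> frobenius_fixed q \<Longrightarrow> x ^ (q ^ k) = x"
  by (induction k) (auto simp: frobenius_fixed_def power_mult)

lemma frobenius_fixed_mono: "frobenius_fixed q \<subseteq> frobenius_fixed (q ^ k)"
  using frobenius_fixed_power by (auto simp: frobenius_fixed_def)

text \<open>The fixed points are the roots of X^q - X. This polynomial splits, and its derivative is
  -1, so it has no double root and hence exactly \<open>q\<close> distinct roots.\<close>

lemma card_frobenius_fixed:
  fixes q e :: nat
  assumes p: "prime CHAR('a)" "q = CHAR('a) ^ e" "e > 0"
  shows "card (frobenius_fixed q :: 'a::alg_closed_field set) = q"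
proof -
  have q1: "q > 1" using p prime_gt_1_nat by (metis one_less_power)
  define P :: "'a poly" where "P = Polynomial.monom 1 q - Polynomial.monom 1 1"
  have poly_P: "poly P x = x ^ q - x" for x by (simp add: P_def poly_monom)
  have deg: "Polynomial.degree P = q"
    unfolding P_def using q1
    by (subst diff_conv_add_uminus, subst degree_add_eq_left)
      (auto simp: Polynomial.degree_monom_eq)
  have P0: "P \<noteq> 0" using deg q1 by auto
  obtain A where A: "size A = Polynomial.degree P"
    "P = smult (Polynomial.lead_coeff P) (\<Prod>x\<in>#A. [:-x, 1:])"
    using alg_closed_imp_factorization[OF P0] by auto
  have roots: "set_mset A = frobenius_fixed q"
  proof -
    have "poly P x = 0 \<longleftrightarrow> x \<in># A" for x
      using P0 by (subst A(2)) (auto simp: poly_prod_mset)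
    thus ?thesis by (auto simp: poly_P frobenius_fixed_def)
  qed
  have pd: "pderiv P = - 1"
  proof -
    have "of_nat q = (0 :: 'a)"
      using p by (simp add: of_nat_eq_0_iff_char_dvd)
    thus ?thesis by (simp add: P_def pderiv_diff pderiv_monom)
  qed
  have cnt: "count A x = 1" if x: "x \<in># A" for x
  proof (rule ccontr)
    assume "count A x \<noteq> 1"
    moreover have "count A x > 0" using x by simp
    ultimately have "x \<in># A - {#x#}" by (simp flip: count_greater_zero_iff)
    then obtain B where B: "A - {#x#} = add_mset x B" by (metis mset_add)
    hence "A = add_mset x (add_mset x B)" using x by (metis insert_DiffM)
    hence "P = [:-x, 1:] * ([:-x, 1:] * smult (Polynomial.lead_coeff P) (\<Prod>x\<in>#B. [:-x, 1:]))"
      using A(2) by (simp add: mult.assoc)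
    then obtain R where "P = [:-x, 1:] * ([:-x, 1:] * R)" by blast
    hence "poly (pderiv P) x = 0" by (simp only: pderiv_mult) simp
    thus False by (simp add: pd)
  qed
  have "card (set_mset A) = size A"
    using cnt by (simp add: size_multiset_overloaded_eq)
  thus ?thesis using A(1) deg roots by simp
qed

lemma finite_frobenius_fixed:
  assumes "prime CHAR('a)" "q = CHAR('a) ^ e" "e > 0"
  shows "finite (frobenius_fixed q :: 'a::alg_closed_field set)"
  using card_frobenius_fixed[OF assms] assms
  by (metis card.infinite prime_gt_0_nat zero_less_power less_irrefl)

section \<open>Linear independence over a subfield\<close>

definition indep_over :: "'a::field set \<Rightarrow> 'i set \<Rightarrow> ('i \<Rightarrow> 'a) \<Rightarrow> bool" where
  "indep_over L I b \<longleftrightarrow>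
     (\<forall>c. c \<in> I \<rightarrow> L \<longrightarrow> (\<Sum>i\<in>I. c i * b i) = 0 \<longrightarrow> (\<forall>i\<in>I. c i = 0))"

text \<open>Greedy choice: fewer than \<open>n\<close> vectors span at most
  \<open>card L ^ (n - 1)\<close> elements, so \<open>M\<close> always contains an element outside
  the current span.\<close>

lemma (in field_subset) exists_indep_over:
  assumes "finite L" "finite M" "n > 0" "card L ^ (n - 1) < card M"
  shows "\<exists>b. b \<in> {..<n} \<rightarrow> M \<and> indep_over L {..<n} b"
proof -
  have "\<exists>b. b \<in> {..<j} \<rightarrow> M \<and> indep_over L {..<j} b" if "j \<le> n" for j
    using that
  proof (induction j)
    case 0
    show ?case by (auto simp: indep_over_def)
  next
    case (Suc j)
    then obtain b where b: "b \<in> {..<j} \<rightarrow> M" "indep_over L {..<j} b" by auto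
    define Sp where "Sp = (\<lambda>c. \<Sum>i<j. c i * b i) ` ({..<j} \<rightarrow>\<^sub>E L)"
    have "card Sp \<le> card ({..<j} \<rightarrow>\<^sub>E L)"
      unfolding Sp_def by (rule card_image_le) (auto intro: finite_PiE assms)
    also have "\<dots> = card L ^ j" by (simp add: card_PiE)
    also have "\<dots> \<le> card L ^ (n - 1)"
    proof (rule power_increasing)
      show "1 \<le> card L" using assms(1) zero_closed
        by (metis One_nat_def Suc_leI card_gt_0_iff empty_iff)
    qed (use Suc in auto)
    also have "\<dots> < card M" by fact
    finally have "card Sp < card M" .
    moreover have "finite Sp" unfolding Sp_def by (auto intro: finite_PiE assms)
    ultimately obtain y where y: "y \<in> M" "y \<notin> Sp"
      by (metis card_mono leD subsetI)
    have "indep_over L {..<Suc j} (b(j := y))"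
      unfolding indep_over_def
    proof (intro allI impI)
      fix c assume c: "c \<in> {..<Suc j} \<rightarrow> L"
        and s: "(\<Sum>i<Suc j. c i * (b(j := y)) i) = 0"
      have s': "(\<Sum>i<j. c i * b i) + c j * y = 0" using s by simp
      have cj: "c j = 0"
      proof (rule ccontr)
        assume n0: "c j \<noteq> 0"
        define d where "d = restrict (\<lambda>i. - c i / c j) {..<j}"
        have "d \<in> {..<j} \<rightarrow>\<^sub>E L" using c by (auto simp: d_def intro!: uminus_closed divide_closed)
        moreover have "y = (\<Sum>i<j. d i * b i)"
        proof -
          have "(\<Sum>i<j. d i * b i) = (\<Sum>i<j. - (c i * b i)) / c j"
            unfolding sum_divide_distrib by (intro sum.cong) (auto simp: d_def)
          also have "\<dots> = y" using s' n0 
            by (simp add: sum_negf add_eq_0_iff2 field_simps)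
          finally show ?thesis ..
        qed
        ultimately have "y \<in> Sp" by (auto simp: Sp_def)
        thus False using y by blast
      qed
      hence "(\<Sum>i<j. c i * b i) = 0" using s' by simp
      moreover have "c \<in> {..<j} \<rightarrow> L" using c by auto
      ultimately have "\<forall>i\<in>{..<j}. c i = 0" using b(2) unfolding indep_over_def by blast
      thus "\<forall>i\<in>{..<Suc j}. c i = 0" using cj by (auto simp: less_Suc_eq)
    qed
    moreover have "b(j := y) \<in> {..<Suc j} \<rightarrow> M" using b y by (auto simp: less_Suc_eq)
    ultimately show ?case by blast
  qed
  thus ?thesis by blast
qed

text \<open>The equations say that \<open>c\<close> annihilates the values of every polynomial of
  degree below \<open>t\<close>. Testing with the product of X - x j over all j other than
  \<open>k\<close> isolates \<open>c k\<close>.\<close>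

lemma vandermonde_kernel:
  fixes x c :: "'i \<Rightarrow> 'a::field"
  assumes "finite G" "inj_on x G" "card G \<le> t"
    and z: "\<And>s. s < t \<Longrightarrow> (\<Sum>k\<in>G. c k * x k ^ s) = 0" and k: "k \<in> G"
  shows "c k = 0"
proof -
  define P where "P = (\<Prod>j\<in>G - {k}. [:- x j, 1:])"
  have "Polynomial.degree P \<le> (\<Sum>j\<in>G - {k}. Polynomial.degree [:- x j, 1:])"
    unfolding P_def using degree_prod_sum_le[of "G - {k}" "\<lambda>j. [:- x j, 1:]"] assms by (simp add: o_def)
  also have "\<dots> = card G - 1" using assms by simp
  also have "\<dots> < t" using assms 
    by (cases "card G") auto
  finally have deg: "Polynomial.degree P < t" .
  have "(\<Sum>j\<in>G. c j * poly P (x j))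
      = (\<Sum>j\<in>G. \<Sum>s\<le>Polynomial.degree P. Polynomial.coeff P s * (c j * x j ^ s))"
    by (simp add: poly_altdef sum_distrib_left mult_ac)
  also have "\<dots> = (\<Sum>s\<le>Polynomial.degree P. Polynomial.coeff P s * (\<Sum>j\<in>G. c j * x j ^ s))"
    by (subst sum.swap) (simp add: sum_distrib_left)
  also have "\<dots> = 0" using deg z by (intro sum.neutral) auto
  finally have "(\<Sum>j\<in>G. c j * poly P (x j)) = 0" .
  moreover have "(\<Sum>j\<in>G. c j * poly P (x j)) = (\<Sum>j\<in>{k}. c j * poly P (x j))"
    using assms by (intro sum.mono_neutral_right) (auto simp: P_def poly_prod)
  ultimately have "c k * poly P (x k) = 0" by simp
  moreover have "poly P (x k) \<noteq> 0"
    using assms by (auto simp: P_def poly_prod inj_on_def)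
  ultimately show ?thesis by simp
qed

text \<open>Comparing coefficients of the independent family \<open>b\<close> turns a dependency
  into a Vandermonde system in the nodes \<open>x k\<close>. This supplies vectors any
  \<open>t\<close> of which are independent.\<close>

lemma (in field_subset) indep_over_vandermonde:
  assumes b: "indep_over L {..<t} b"
    and x: "finite G" "inj_on x G" "x \<in> G \<rightarrow> L" "card G \<le> t"
  shows "indep_over L G (\<lambda>k. \<Sum>s<t. x k ^ s * b s)"
  unfolding indep_over_def
proof (intro allI impI ballI)
  fix c k assume c: "c \<in> G \<rightarrow> L" and k: "k \<in> G"
    and "(\<Sum>k\<in>G. c k * (\<Sum>s<t. x k ^ s * b s)) = 0"
  hence "0 = (\<Sum>k\<in>G. \<Sum>s<t. c k * x k ^ s * b s)" by (simp add: sum_distrib_left mult_ac)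
  also have "\<dots> = (\<Sum>s<t. (\<Sum>k\<in>G. c k * x k ^ s) * b s)"
    by (subst sum.swap) (simp add: sum_distrib_right)
  finally have "(\<Sum>s<t. (\<Sum>k\<in>G. c k * x k ^ s) * b s) = 0" ..
  moreover have "(\<lambda>s. \<Sum>k\<in>G. c k * x k ^ s) \<in> {..<t} \<rightarrow> L"
    using c x by (auto simp: Pi_iff intro!: sum_closed mult_closed power_closed)
  ultimately have "\<forall>s<t. (\<Sum>k\<in>G. c k * x k ^ s) = 0"
    using b unfolding indep_over_def by blast
  thus "c k = 0" using vandermonde_kernel[of G x t c k] x k by blast
qed

section \<open>Kernel of a Moore matrix stacked on local Vandermonde blocks\<close>

text \<open>
  Normalise a kernel vector \<open>c\<close> so that some \<open>c\<^sub>j = 1\<close>. Then \<open>c\<^sup>q - c\<close> satisfies the same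
  local equations, since their coefficients are fixed by the Frobenius map, and one fewer global
  equation, with \<open>\<beta>\<close> replaced by \<open>\<beta>\<^sup>q\<close>; as it vanishes at \<open>j\<close>, the induction hypothesis on the
  remaining columns shows that \<open>c\<close> has entries in \<open>GF(q)\<close>. Groups with exactly \<open>a\<close> columns never
  meet the support of \<open>c\<close>.
\<close>
lemma local_moore_kernel:
  fixes \<alpha> \<beta> c :: "'j \<Rightarrow> 'a::field" and grp :: "'j \<Rightarrow> 'k" and q t :: nat
  assumes p: "prime CHAR('a)" "q = CHAR('a) ^ e"
    and G: "finite G" "min h (card G) \<le> t"
    and "finite S" "grp ` S \<subseteq> G"
    and "\<And>j. j \<in> S \<Longrightarrow> \<alpha> j \<in> frobenius_fixed q"
    and "\<And>k. k \<in> G \<Longrightarrow> inj_on \<alpha> {j\<in>S. grp j = k}"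
    and "\<And>k. k \<in> G \<Longrightarrow> a \<le> card {j\<in>S. grp j = k}"
    and "card S = card G * a + h"
    and "\<And>k u. k \<in> G \<Longrightarrow> u < a \<Longrightarrow> (\<Sum>j | j \<in> S \<and> grp j = k. c j * \<alpha> j ^ u) = 0"
    and "\<And>i. i < h \<Longrightarrow> (\<Sum>j\<in>S. c j * \<beta> j ^ (q ^ i)) = 0"
    and "\<And>d. (\<And>j. j \<in> S \<Longrightarrow> d j \<in> frobenius_fixed q) \<Longrightarrow>
           card (grp ` {j\<in>S. d j \<noteq> 0}) \<le> t \<Longrightarrow> (\<Sum>j\<in>S. d j * \<beta> j) = 0 \<Longrightarrow> \<forall>j\<in>S. d j = 0"
  shows "\<forall>j\<in>S. c j = 0"
  using assms(4-)
proof (induction h arbitrary: S \<beta> c)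
  have sum_card: "(\<Sum>k\<in>G. card {j\<in>S. grp j = k}) = card S"
    if "finite S" "grp ` S \<subseteq> G" for S
    using sum.group[of S G grp "\<lambda>_. 1 :: nat"] that G(1) by simp
  have big: "card {j\<in>S. grp j = grp j0} > a"
    if "finite S" "grp ` S \<subseteq> G" "j0 \<in> S" "c j0 \<noteq> 0"
      "\<And>k. k \<in> G \<Longrightarrow> inj_on \<alpha> {j\<in>S. grp j = k}"
      "\<And>k u. k \<in> G \<Longrightarrow> u < a \<Longrightarrow> (\<Sum>j | j \<in> S \<and> grp j = k. c j * \<alpha> j ^ u) = 0"
    for S and c :: "'j \<Rightarrow> 'a" and j0
  proof (rule ccontr)
    assume "\<not> ?thesis"
    \<comment> \<open>With at most \<open>a\<close> columns in the group, the \<open>a\<close> local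
      equations form a Vandermonde system of full column rank.\<close>
    hence "c j0 = 0"
      using that by (intro vandermonde_kernel[of "{j\<in>S. grp j = grp j0}" \<alpha> a c j0]) auto
    thus False using that by simp
  qed
  {
    case (0 S \<beta> c)
    show ?case
    proof (rule ccontr)
      assume "\<not> ?case"
      then obtain j0 where j0: "j0 \<in> S" "c j0 \<noteq> 0" by auto
      \<comment> \<open>With h = 0 there are no surplus columns, so a group with more than
        \<open>a\<close> columns contradicts the total count.\<close>
      have "(\<Sum>k\<in>G. a) < (\<Sum>k\<in>G. card {j\<in>S. grp j = k})"
      proof (rule sum_strict_mono_ex1)
        have "grp j0 \<in> G" using "0.prems" j0 by auto
        moreover have "a < card {j\<in>S. grp j = grp j0}"
          using "0.prems" j0 by (intro big[of S j0 c]) auto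
        ultimately show "\<exists>k\<in>G. a < card {j\<in>S. grp j = k}" by blast
      qed (use "0.prems" G in auto)
      also have "\<dots> = card S" using "0.prems"(2,3) sum_card by blast
      finally show False using "0.prems"(7) by simp
    qed
  next
    case (Suc h S \<beta> c)
    show ?case
    proof (rule ccontr)
      assume "\<not> ?case"
      then obtain j0 where j0: "j0 \<in> S" "c j0 \<noteq> 0" by auto
      define c' where "c' = (\<lambda>j. c j / c j0)"
      define S' where "S' = S - {j0}"
      define f where "f = (\<lambda>j. c' j ^ q - c' j)"
      have q0: "q > 0" using p by (simp add: prime_gt_0_nat)
      have loc: "(\<Sum>j | j \<in> S \<and> grp j = k. c' j * \<alpha> j ^ u) = 0" if "k \<in> G" "u < a" for k u
        using Suc.prems(8)[OF that] unfolding c'_def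
        by (simp add: sum_divide_distrib[symmetric])
      have glob: "(\<Sum>j\<in>S. c' j * \<beta> j ^ (q ^ i)) = 0" if "i < Suc h" for i
        using Suc.prems(9)[OF that] unfolding c'_def
        by (simp add: sum_divide_distrib[symmetric])
      have f0: "f j0 = 0" using j0 by (simp add: f_def c'_def)
      have "\<forall>j\<in>S'. f j = 0"
      proof (rule Suc.IH[where \<beta> = "\<lambda>j. \<beta> j ^ q"])
        show "min h (card G) \<le> t" using Suc.prems(1) by linarith
        show "finite S'" "grp ` S' \<subseteq> G" "\<And>j. j \<in> S' \<Longrightarrow> \<alpha> j \<in> frobenius_fixed q"
          using Suc.prems(2-4) by (auto simp: S'_def)
        show "inj_on \<alpha> {j\<in>S'. grp j = k}" if "k \<in> G" for k
          using Suc.prems(5)[OF that] by (rule inj_on_subset) (auto simp: S'_def)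
        \<comment> \<open>Deleting \<open>j0\<close> is safe because its group, meeting the support
          of \<open>c\<close>, has at least \<open>a + 1\<close> columns.\<close>
        show "a \<le> card {j\<in>S'. grp j = k}" if "k \<in> G" for k
        proof (cases "grp j0 = k")
          case True
          have "{j\<in>S'. grp j = k} = {j\<in>S. grp j = k} - {j0}" by (auto simp: S'_def)
          moreover have "a < card {j\<in>S. grp j = k}"
            using big[OF Suc.prems(2,3) j0 Suc.prems(5,8)] True by simp
          ultimately show ?thesis using True j0 Suc.prems(2) by simp
        next
          case False
          hence "{j\<in>S'. grp j = k} = {j\<in>S. grp j = k}" by (auto simp: S'_def)
          thus ?thesis using Suc.prems(6) that by simp
        qed
        show "card S' = card G * a + h" using Suc.prems(2,7) j0 by (simp add: S'_def)
        show "(\<Sum>j | j \<in> S' \<and> grp j = k. f j * \<alpha> j ^ u) = 0" if "k \<in> G" "u < a" for k u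
        proof -
          have "(\<Sum>j | j \<in> S' \<and> grp j = k. f j * \<alpha> j ^ u)
              = (\<Sum>j | j \<in> S \<and> grp j = k. f j * \<alpha> j ^ u)"
            using f0 Suc.prems(2) by (intro sum.mono_neutral_left) (auto simp: S'_def)
          also have "\<dots> = (\<Sum>j | j \<in> S \<and> grp j = k. (c' j * \<alpha> j ^ u) ^ q - c' j * \<alpha> j ^ u)"
          proof (intro sum.cong refl)
            fix j assume j: "j \<in> {j \<in> S. grp j = k}"
            hence "(\<alpha> j ^ u) ^ q = \<alpha> j ^ u"
              using Suc.prems(4) by (auto simp: frobenius_fixed_def power_commutes
                 simp flip: power_mult) (metis mult.commute power_mult)
            thus "f j * \<alpha> j ^ u = (c' j * \<alpha> j ^ u) ^ q - c' j * \<alpha> j ^ u"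
              by (simp add: f_def power_mult_distrib algebra_simps)
          qed
          also have "\<dots> = (\<Sum>j | j \<in> S \<and> grp j = k. c' j * \<alpha> j ^ u) ^ q
              - (\<Sum>j | j \<in> S \<and> grp j = k. c' j * \<alpha> j ^ u)"
            by (simp add: sum_subtractf frobenius_sum[OF p])
          finally show ?thesis using loc[OF that] q0 by simp
        qed
        \<comment> \<open>This is the q-th power of global equation \<open>i\<close> minus global
          equation \<open>Suc i\<close>; pairing consecutive equations is what costs one of
          them.\<close>
        show "(\<Sum>j\<in>S'. f j * (\<beta> j ^ q) ^ (q ^ i)) = 0" if "i < h" for i
        proof -
          have "(\<Sum>j\<in>S'. f j * (\<beta> j ^ q) ^ (q ^ i)) = (\<Sum>j\<in>S. f j * (\<beta> j ^ q) ^ (q ^ i))"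
            using f0 Suc.prems(2) by (intro sum.mono_neutral_left) (auto simp: S'_def)
          also have "\<dots> = (\<Sum>j\<in>S. (c' j * \<beta> j ^ (q ^ i)) ^ q - c' j * \<beta> j ^ (q ^ Suc i))"
            by (intro sum.cong refl)
              (simp add: f_def power_mult_distrib algebra_simps flip: power_mult)
          also have "\<dots> = (\<Sum>j\<in>S. c' j * \<beta> j ^ (q ^ i)) ^ q - (\<Sum>j\<in>S. c' j * \<beta> j ^ (q ^ Suc i))"
            by (simp add: sum_subtractf frobenius_sum[OF p])
          finally show ?thesis using glob[of i] glob[of "Suc i"] that q0 by simp
        qed
        show "\<forall>j\<in>S'. d j = 0"
          if d: "\<And>j. j \<in> S' \<Longrightarrow> d j \<in> frobenius_fixed q" "card (grp ` {j\<in>S'. d j \<noteq> 0}) \<le> t"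
            "(\<Sum>j\<in>S'. d j * \<beta> j ^ q) = 0" for d
        proof -
          \<comment> \<open>The independence hypothesis for \<beta> passes to its q-th powers:
            \<open>d'\<close> has entries fixed by Frobenius, so the relation for the powers is the
            q-th power of a relation for \<beta>.\<close>
          define d' where "d' = d(j0 := 0)"
          have "\<forall>j\<in>S. d' j = 0"
          proof (rule Suc.prems(10))
            show "d' j \<in> frobenius_fixed q" if "j \<in> S" for j
              using d(1) that q0 by (auto simp: d'_def S'_def frobenius_fixed_def)
            have "{j\<in>S. d' j \<noteq> 0} = {j\<in>S'. d j \<noteq> 0}" by (auto simp: d'_def S'_def)
            thus "card (grp ` {j\<in>S. d' j \<noteq> 0}) \<le> t" using d(2) by simp
            have "(\<Sum>j\<in>S. d' j * \<beta> j) ^ q = (\<Sum>j\<in>S. d' j ^ q * \<beta> j ^ q)"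
              by (simp add: frobenius_sum[OF p] power_mult_distrib)
            also have "\<dots> = (\<Sum>j\<in>S'. d' j ^ q * \<beta> j ^ q)"
              using Suc.prems(2) q0 by (intro sum.mono_neutral_right) (auto simp: S'_def d'_def)
            also have "\<dots> = (\<Sum>j\<in>S'. d j * \<beta> j ^ q)"
              using d(1) by (intro sum.cong) (auto simp: d'_def S'_def frobenius_fixed_def)
            finally show "(\<Sum>j\<in>S. d' j * \<beta> j) = 0" using d(3) q0 by simp
          qed
          thus ?thesis unfolding d'_def S'_def by (metis DiffE fun_upd_other insertI1)
        qed
      qed
      hence c'_fixed: "c' j \<in> frobenius_fixed q" if "j \<in> S" for j
        using f0 that by (cases "j = j0") (auto simp: frobenius_fixed_def f_def S'_def)
      have "card (grp ` {j\<in>S. c' j \<noteq> 0}) \<le> min (Suc h) (card G)"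
      proof -
        define B where "B = {k\<in>G. card {j\<in>S. grp j = k} > a}"
        have sub: "grp ` {j\<in>S. c' j \<noteq> 0} \<subseteq> B"
        proof (intro image_subsetI)
          fix j assume "j \<in> {j\<in>S. c' j \<noteq> 0}"
          hence "j \<in> S" "c j \<noteq> 0" by (auto simp: c'_def)
          thus "grp j \<in> B"
            using big[OF Suc.prems(2,3) _ _ Suc.prems(5,8)] Suc.prems(3) by (auto simp: B_def)
        qed
        have BG: "finite B" "B \<subseteq> G" using G by (auto simp: B_def)
        \<comment> \<open>Each group in \<open>B\<close> uses up at least one of the
          \<open>Suc h\<close> surplus columns.\<close>
        have "card G * a + card B = (\<Sum>k\<in>G. a + (if k \<in> B then 1 else 0))"
          using BG G by (simp add: sum.distrib sum.If_cases Int_absorb1)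
        also have "\<dots> \<le> (\<Sum>k\<in>G. card {j\<in>S. grp j = k})"
          using Suc.prems(6) by (intro sum_mono) (auto simp: B_def Suc_le_eq)
        also have "\<dots> = card G * a + Suc h" using Suc.prems(2,3,7) sum_card[of S] by simp
        finally have "card B \<le> Suc h" by simp
        moreover have "card B \<le> card G" using BG G card_mono by blast
        moreover have "card (grp ` {j\<in>S. c' j \<noteq> 0}) \<le> card B" using sub BG card_mono by blast
        ultimately show ?thesis by simp
      qed
      hence "card (grp ` {j\<in>S. c' j \<noteq> 0}) \<le> t" using Suc.prems(1) by linarith
      hence "\<forall>j\<in>S. c' j = 0"
        using c'_fixed glob[of 0] by (intro Suc.prems(10)) auto
      thus False using j0 by (auto simp: c'_def)
    qed
  }
qed

section \<open>Transfer between HOL-Algebra fields and the ambient type-class field\<close>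

locale field_embedding = F: Ring.field F for F :: "('b, 'c) ring_scheme" (structure) +
  fixes \<phi> :: "'b \<Rightarrow> 'a::field"
  assumes inj: "inj_on \<phi> (carrier F)"
    and image_field: "field_subset (\<phi> ` carrier F)"
    and \<phi>_zero [simp]: "\<phi> \<zero> = 0"
    and \<phi>_add: "x \<in> carrier F \<Longrightarrow> y \<in> carrier F \<Longrightarrow> \<phi> (x \<oplus> y) = \<phi> x + \<phi> y"
    and \<phi>_mult: "x \<in> carrier F \<Longrightarrow> y \<in> carrier F \<Longrightarrow> \<phi> (x \<otimes> y) = \<phi> x * \<phi> y"
begin

lemma \<phi>_eq_0_iff: "x \<in> carrier F \<Longrightarrow> \<phi> x = 0 \<longleftrightarrow> x = \<zero>"
  using inj_onD[OF inj, of x \<zero>] by auto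

lemma \<phi>_finsum:
  "f \<in> A \<rightarrow> carrier F \<Longrightarrow> \<phi> (finsum F f A) = (\<Sum>x\<in>A. \<phi> (f x))"
proof (induction A rule: infinite_finite_induct)
  case (infinite A)
  thus ?case by simp
next
  case (insert x A)
  hence "f \<in> A \<rightarrow> carrier F" "f x \<in> carrier F" by auto
  thus ?case using insert by (simp add: F.finsum_insert \<phi>_add F.finsum_closed)
qed auto

lemma \<phi>_lincomb_eq_0_iff:
  assumes "\<And>j. j \<in> S \<Longrightarrow> c j \<in> carrier F" "\<And>j. j \<in> S \<Longrightarrow> v j \<in> carrier F"
  shows "finsum F (\<lambda>j. c j \<otimes> v j) S = \<zero> \<longleftrightarrow> (\<Sum>j\<in>S. \<phi> (c j) * \<phi> (v j)) = 0"
proof -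
  have "\<phi> (finsum F (\<lambda>j. c j \<otimes> v j) S) = (\<Sum>j\<in>S. \<phi> (c j) * \<phi> (v j))"
    using assms by (subst \<phi>_finsum) (auto simp: \<phi>_mult intro!: sum.cong)
  moreover have "finsum F (\<lambda>j. c j \<otimes> v j) S \<in> carrier F"
    using assms by (intro F.finsum_closed) auto
  ultimately show ?thesis using \<phi>_eq_0_iff by metis
qed

lemma lin_indep_familyI:
  assumes "\<And>j i. j \<in> S \<Longrightarrow> i < m \<Longrightarrow> v j i \<in> carrier F"
    and "\<And>c. (\<And>j. j \<in> S \<Longrightarrow> c j \<in> \<phi> ` carrier F) \<Longrightarrow>
      (\<And>i. i < m \<Longrightarrow> (\<Sum>j\<in>S. c j * \<phi> (v j i)) = 0) \<Longrightarrow> \<forall>j\<in>S. c j = 0"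
  shows "lin_indep_family F S m v"
  unfolding lin_indep_family_def
proof (intro allI impI)
  fix c assume c: "c \<in> S \<rightarrow> carrier F"
    and z: "\<forall>i<m. finsum F (\<lambda>j. c j \<otimes> v j i) S = \<zero>"
  have "\<forall>j\<in>S. \<phi> (c j) = 0"
  proof (rule assms(2))
    show "\<phi> (c j) \<in> \<phi> ` carrier F" if "j \<in> S" for j using c that by auto
    show "(\<Sum>j\<in>S. \<phi> (c j) * \<phi> (v j i)) = 0" if "i < m" for i
      using z \<phi>_lincomb_eq_0_iff[of S c "\<lambda>j. v j i"] c assms(1) that by auto
  qed
  thus "\<forall>j\<in>S. c j = \<zero>" using c \<phi>_eq_0_iff by auto
qed

text \<open>This is a Reed-Solomon code: row combinations evaluate polynomials of degree below
  \<open>a\<close> at distinct nodes, so a nonzero one vanishes at no more than \<open>a - 1\<close>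
  positions.\<close>

lemma generates_MDS_vandermonde:
  fixes \<alpha> :: "nat \<Rightarrow> 'a"
  assumes a: "0 < a" "a \<le> r" and \<alpha>: "inj_on \<alpha> {..<r}"
    and A: "\<And>i j. i < a \<Longrightarrow> j < r \<Longrightarrow> A i j \<in> carrier F"
    and A\<alpha>: "\<And>i j. i < a \<Longrightarrow> j < r \<Longrightarrow> \<phi> (A i j) = \<alpha> j ^ i"
  shows "generates_MDS F r a A"
proof -
  interpret L: field_subset "\<phi> ` carrier F" by (rule image_field)
  define P where "P = (\<lambda>c. \<Sum>i<a. Polynomial.monom (\<phi> (c i)) i)"
  have deg: "Polynomial.degree (P c) \<le> a - 1" for c
    unfolding P_def
    by (intro degree_sum_le) (auto intro: order_trans[OF Polynomial.degree_monom_le])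
  have row: "row_comb F a A c j \<in> carrier F \<and> \<phi> (row_comb F a A c j) = poly (P c) (\<alpha> j)"
    if "c \<in> {..<a} \<rightarrow> carrier F" "j < r" for c j
  proof
    have cA: "(\<lambda>i. c i \<otimes> A i j) \<in> {..<a} \<rightarrow> carrier F" using that A by auto
    thus "row_comb F a A c j \<in> carrier F" unfolding row_comb_def by (rule F.finsum_closed)
    have "\<phi> (row_comb F a A c j) = (\<Sum>i<a. \<phi> (c i \<otimes> A i j))"
      unfolding row_comb_def by (rule \<phi>_finsum[OF cA])
    also have "\<dots> = (\<Sum>i<a. \<phi> (c i) * \<alpha> j ^ i)"
      using that A A\<alpha> by (intro sum.cong) (auto simp: \<phi>_mult Pi_iff)
    finally show "\<phi> (row_comb F a A c j) = poly (P c) (\<alpha> j)"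
      by (simp add: P_def poly_sum poly_monom)
  qed
  have zeros: "card {j. j < r \<and> poly Q (\<alpha> j) = 0} \<le> Polynomial.degree Q" if "Q \<noteq> 0" for Q
  proof -
    have "card {j. j < r \<and> poly Q (\<alpha> j) = 0} = card (\<alpha> ` {j. j < r \<and> poly Q (\<alpha> j) = 0})"
      using \<alpha> by (intro card_image[symmetric]) (auto simp: inj_on_def)
    also have "\<dots> \<le> card {x. poly Q x = 0}"
      by (intro card_mono) (use that poly_roots_finite in auto)
    also have "\<dots> \<le> Polynomial.degree Q" using that by (rule card_poly_roots_bound)
    finally show ?thesis .
  qed
  have weight: "hweight F r (row_comb F a A c) = r - card {j. j < r \<and> poly (P c) (\<alpha> j) = 0}"
    if "c \<in> {..<a} \<rightarrow> carrier F" for c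
  proof -
    have "{j. j < r \<and> row_comb F a A c j \<noteq> \<zero>} = {..<r} - {j. j < r \<and> poly (P c) (\<alpha> j) = 0}"
      using row[OF that] \<phi>_eq_0_iff by fastforce
    thus ?thesis unfolding hweight_def by (simp add: card_Diff_subset subset_eq)
  qed
  have indep: "lin_indep_family F {..<a} r A"
  proof (rule lin_indep_familyI)
    fix c :: "nat \<Rightarrow> 'a"
    assume z: "\<And>j. j < r \<Longrightarrow> (\<Sum>i<a. c i * \<phi> (A i j)) = 0"
    define Q where "Q = (\<Sum>i<a. Polynomial.monom (c i) i)"
    have "poly Q (\<alpha> j) = 0" if "j < r" for j
      using z[OF that] that A\<alpha> by (simp add: Q_def poly_sum poly_monom)
    hence "{j. j < r \<and> poly Q (\<alpha> j) = 0} = {..<r}" by auto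
    moreover have "Polynomial.degree Q \<le> a - 1"
      unfolding Q_def
      by (intro degree_sum_le) (auto intro: order_trans[OF Polynomial.degree_monom_le])
    ultimately have "Q = 0" using zeros[of Q] a by fastforce
    moreover have "Polynomial.coeff Q i = c i" if "i < a" for i
      using that by (simp add: Q_def Polynomial.coeff_sum)
    ultimately show "\<forall>i\<in>{..<a}. c i = 0" by (metis Polynomial.coeff_0 lessThan_iff)
  qed (use A in auto)
  have dist: "hweight F r (row_comb F a A c) \<ge> r - a + 1"
    if c: "c \<in> {..<a} \<rightarrow> carrier F" "\<exists>j<r. row_comb F a A c j \<noteq> \<zero>" for c
  proof -
    obtain j where "j < r" "row_comb F a A c j \<noteq> \<zero>" using c by auto
    hence "poly (P c) (\<alpha> j) \<noteq> 0" using row[OF c(1)] \<phi>_eq_0_iff by metis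
    hence "P c \<noteq> 0" by auto
    thus ?thesis using zeros[of "P c"] deg[of c] weight[OF c(1)] a by simp
  qed
  \<comment> \<open>A codeword of minimum weight comes from the monic polynomial
    \<open>R (a - 1)\<close>, whose roots are the first \<open>a - 1\<close> nodes.\<close>
  define R where "R = (\<lambda>n. \<Prod>j<n. [:- \<alpha> j, 1:])"
  \<comment> \<open>The nodes are read off matrix row 1, which exists only for \<open>1 < a\<close>.
    For \<open>a = 1\<close> the polynomial is the constant 1 and involves no nodes.\<close>
  have \<alpha>L: "\<alpha> j \<in> \<phi> ` carrier F" if "j < r" "1 < a" for j
    using A[of 1 j] A\<alpha>[of 1 j] that by force
  have coeff_R: "Polynomial.coeff (R n) i \<in> \<phi> ` carrier F" if "n < a" for n i
    using that
  proof (induction n arbitrary: i)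
    case 0
    thus ?case by (auto simp: R_def one_pCons Polynomial.coeff_pCons split: nat.splits)
  next
    case (Suc n)
    have "R (Suc n) = [:- \<alpha> n, 1:] * R n" by (simp add: R_def mult.commute)
    thus ?case using Suc a
      by (auto simp: Polynomial.coeff_pCons split: nat.splits
          intro!: L.add_closed L.diff_closed L.uminus_closed L.mult_closed \<alpha>L)
  qed
  define c where "c = (\<lambda>i. inv_into (carrier F) \<phi> (Polynomial.coeff (R (a - 1)) i))"
  have c: "c i \<in> carrier F" "\<phi> (c i) = Polynomial.coeff (R (a - 1)) i" for i
    using coeff_R[of "a - 1" i] a by (auto simp: c_def inv_into_into f_inv_into_f)
  have "Polynomial.degree (R (a - 1)) \<le> a - 1"
    unfolding R_def using degree_prod_sum_le[of "{..<a - 1}" "\<lambda>j. [:- \<alpha> j, 1:]"]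
    by (simp add: o_def)
  hence Pc: "P c = R (a - 1)"
    using a by (intro poly_eqI) (auto simp: P_def c(2) Polynomial.coeff_sum sum.delta
      if_distrib Polynomial.coeff_eq_0 not_less cong: if_cong)
  have root: "poly (P c) (\<alpha> j) = 0 \<longleftrightarrow> j < a - 1" if "j < r" for j
  proof -
    have "\<alpha> j = \<alpha> i \<longleftrightarrow> j = i" if "i < a - 1" for i
      using inj_on_eq_iff[OF \<alpha>, of j i] that \<open>j < r\<close> a by auto
    thus ?thesis unfolding Pc R_def by (auto simp: poly_prod)
  qed
  have c': "c \<in> {..<a} \<rightarrow> carrier F" using c by auto
  have "row_comb F a A c (a - 1) \<noteq> \<zero>"
  proof -
    have "a - 1 < r" using a by simp
    thus ?thesis using root[of "a - 1"] row[OF c', of "a - 1"] by auto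
  qed
  moreover have "{j. j < r \<and> poly (P c) (\<alpha> j) = 0} = {..<a - 1}" using root a by auto
  hence "hweight F r (row_comb F a A c) = r - a + 1" using weight[OF c'] a by simp
  ultimately have "\<exists>c. c \<in> {..<a} \<rightarrow> carrier F \<and> (\<exists>j<r. row_comb F a A c j \<noteq> \<zero>) \<and>
      hweight F r (row_comb F a A c) = r - a + 1"
    using c' a by (intro exI[of _ c]) (auto intro!: exI[of _ "a - 1"])
  thus ?thesis unfolding generates_MDS_def using A indep dist by blast
qed

end

text \<open>The field structure is transported along a bijection with an initial segment of the
  naturals, as the final statement asks for a ring on \<open>nat\<close>.\<close>

lemma (in field_subset) exists_nat_field_embedding:
  assumes "finite L"
  shows "\<exists>(F :: nat ring) \<phi>. field_embedding F \<phi> \<and> \<phi> ` carrier F = L"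
proof -
  obtain f where f: "bij_betw f L {0..<card L}"
    using ex_bij_betw_finite_nat[OF assms] by blast
  define \<phi> where "\<phi> = inv_into L f"
  have \<phi>f [simp]: "\<phi> (f x) = x" if "x \<in> L" for x
    using f that by (simp add: \<phi>_def bij_betw_def)
  define F :: "nat ring" where
    "F = \<lparr>carrier = f ` L, monoid.mult = (\<lambda>x y. f (\<phi> x * \<phi> y)), one = f 1,
          ring.zero = f 0, add = (\<lambda>x y. f (\<phi> x + \<phi> y))\<rparr>"
  have F [simp]: "carrier F = f ` L" "\<one>\<^bsub>F\<^esub> = f 1" "\<zero>\<^bsub>F\<^esub> = f 0"
    "x \<otimes>\<^bsub>F\<^esub> y = f (\<phi> x * \<phi> y)" "x \<oplus>\<^bsub>F\<^esub> y = f (\<phi> x + \<phi> y)" for x y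
    by (auto simp: F_def)
  have f_eq: "f x = f y \<longleftrightarrow> x = y" if "x \<in> L" "y \<in> L" for x y
    using f that by (auto simp: bij_betw_def inj_on_def)
  have "abelian_group F"
  proof (rule abelian_groupI)
    fix x assume "x \<in> carrier F"
    then obtain x' where "x = f x'" "x' \<in> L" by auto
    thus "\<exists>y\<in>carrier F. y \<oplus>\<^bsub>F\<^esub> x = \<zero>\<^bsub>F\<^esub>"
      by (auto intro!: bexI[of _ "- x'"] simp: uminus_closed)
  qed (auto simp: add_closed add_ac)
  moreover have "comm_monoid F"
    by (rule comm_monoidI) (auto simp: mult_closed mult_ac)
  ultimately have "cring F"
    by (rule cringI) (auto simp: mult_closed add_closed algebra_simps)
  hence "Ring.field F"
  proof (rule cring.cring_fieldI2)
    show "\<zero>\<^bsub>F\<^esub> \<noteq> \<one>\<^bsub>F\<^esub>" by (simp add: f_eq)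
    fix x assume "x \<in> carrier F" "x \<noteq> \<zero>\<^bsub>F\<^esub>"
    then obtain x' where "x = f x'" "x' \<in> L" "x' \<noteq> 0" by auto
    thus "\<exists>y\<in>carrier F. x \<otimes>\<^bsub>F\<^esub> y = \<one>\<^bsub>F\<^esub>"
      by (auto intro!: bexI[of _ "inverse x'"] simp: inverse_closed)
  qed
  moreover have img: "\<phi> ` carrier F = L" by force
  ultimately have "field_embedding F \<phi>"
    using f field_subset_axioms unfolding field_embedding_def field_embedding_axioms_def
    by (auto simp: inj_on_def add_closed mult_closed image_image)
  thus ?thesis using img by blast
qed

section \<open>Construction of the code\<close>

text \<open>Each size bound pays for one choice: \<open>r \<le> q\<close> for distinct local nodes
  in GF(q), \<open>r \<le> m\<close> for the independent \<open>w j\<close>, and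
  \<open>g \<le> q ^ m\<close> for distinct points \<open>x k\<close> defining the vectors
  \<open>v k\<close>.\<close>

lemma exists_MR_LRC:
  fixes q e m a r g h :: nat
  assumes p: "prime CHAR('a::alg_closed_field)" "q = CHAR('a) ^ e" "e > 0"
    and bounds: "0 < a" "a < r" "r \<le> q" "r \<le> m" "g \<le> q ^ m" "0 < g" "0 < h"
  shows "\<exists>F :: nat ring. Ring.field F \<and> finite (carrier F) \<and>
    card (carrier F) = (q ^ m) ^ min h g \<and> has_MR_LRC F g r h a"
proof -
  define t where "t = min h g"
  define K0 K1 K2 :: "'a set" where
    "K0 = frobenius_fixed q" and "K1 = frobenius_fixed (q ^ m)"
    and "K2 = frobenius_fixed ((q ^ m) ^ t)"
  have t: "t > 0" and m: "m > 0" using bounds by (auto simp: t_def)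
  have q1: "q > 1" using p prime_gt_1_nat by (metis one_less_power)
  have p1: "q ^ m = CHAR('a) ^ (e * m)" and p2: "(q ^ m) ^ t = CHAR('a) ^ (e * m * t)"
    by (auto simp: p(2) power_mult)
  have e12: "e * m > 0" "e * m * t > 0" using p m t by auto
  interpret K0: field_subset K0 unfolding K0_def by (rule field_subset_frobenius_fixed[OF p(1,2)])
  interpret K1: field_subset K1 unfolding K1_def by (rule field_subset_frobenius_fixed[OF p(1) p1])
  interpret K2: field_subset K2 unfolding K2_def by (rule field_subset_frobenius_fixed[OF p(1) p2])
  have fin: "finite K0" "finite K1" "finite K2"
    unfolding K0_def K1_def K2_def
    using finite_frobenius_fixed[OF p] finite_frobenius_fixed[OF p(1) p1]
      finite_frobenius_fixed[OF p(1) p2] e12 by auto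
  have card: "card K0 = q" "card K1 = q ^ m" "card K2 = (q ^ m) ^ t"
    unfolding K0_def K1_def K2_def
    using card_frobenius_fixed[OF p] card_frobenius_fixed[OF p(1) p1]
      card_frobenius_fixed[OF p(1) p2] e12 by auto
  have sub: "K0 \<subseteq> K1" "K1 \<subseteq> K2"
    unfolding K0_def K1_def K2_def by (rule frobenius_fixed_mono)+

  obtain \<alpha> :: "nat \<Rightarrow> 'a" where \<alpha>: "inj_on \<alpha> {..<r}" "\<alpha> ` {..<r} \<subseteq> K0"
    using card_le_inj[of "{..<r}" K0] fin card bounds by auto
  obtain x :: "nat \<Rightarrow> 'a" where x: "inj_on x {..<g}" "x ` {..<g} \<subseteq> K1"
    using card_le_inj[of "{..<g}" K1] fin card bounds by auto
  obtain w where w: "w \<in> {..<r} \<rightarrow> K1" "indep_over K0 {..<r} w"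
  proof -
    have "q ^ (r - 1) < q ^ m" using q1 bounds by (intro power_strict_increasing) auto
    thus ?thesis using K0.exists_indep_over[of K1 r] fin card bounds that by auto
  qed
  obtain b where b: "b \<in> {..<t} \<rightarrow> K2" "indep_over K1 {..<t} b"
  proof -
    have "(q ^ m) ^ (t - 1) < (q ^ m) ^ t"
      using q1 m t by (intro power_strict_increasing one_less_power) auto
    thus ?thesis using K1.exists_indep_over[of K2 t] fin card t that by auto
  qed
  define v where "v = (\<lambda>k. \<Sum>s<t. x k ^ s * b s)"
  define \<beta> where "\<beta> = (\<lambda>j. w (j mod r) * v (j div r))"
  \<comment> \<open>A local row \<open>i\<close> belongs to group \<open>i div a\<close> and carries
    the exponent \<open>i mod a\<close>; the global rows are renumbered from 0 by subtracting
    \<open>g * a\<close>.\<close>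
  define M where "M = (\<lambda>i j. if i < g * a
     then if i div a = j div r then \<alpha> (j mod r) ^ (i mod a) else 0
     else \<beta> j ^ (q ^ (i - g * a)))"

  obtain F :: "nat ring" and \<phi> where "field_embedding F \<phi>" and img: "\<phi> ` carrier F = K2"
    using K2.exists_nat_field_embedding[OF fin(3)] by blast
  interpret field_embedding F \<phi> by fact
  \<comment> \<open>The matrix is computed in the ambient field and pulled back entry by entry,
    which is meaningful for the columns \<open>j < g * r\<close>.\<close>
  define H where "H = (\<lambda>i j. inv_into (carrier F) \<phi> (M i j))"

  have v_closed: "v k \<in> K2" if "k < g" for k
    unfolding v_def using that x b sub by (intro K2.sum_closed K2.mult_closed K2.power_closed) auto
  have M_closed: "M i j \<in> K2" if "j < g * r" for i j
  proof -
    have jr: "j div r < g" "j mod r < r"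
      using that bounds by (auto simp: less_mult_imp_div_less)
    have "\<alpha> (j mod r) \<in> K2" using \<alpha> sub jr by auto
    moreover have "\<beta> j \<in> K2"
      unfolding \<beta>_def using w sub jr v_closed by (intro K2.mult_closed) auto
    ultimately show ?thesis
      unfolding M_def by (auto intro: K2.power_closed)
  qed
  have H: "H i j \<in> carrier F" "\<phi> (H i j) = M i j" if "j < g * r" for i j
    using M_closed[OF that] img by (auto simp: H_def inv_into_into f_inv_into_f)
  have div_eq: "j div r = k \<longleftrightarrow> k * r \<le> j \<and> j < k * r + r" for j k
  proof -
    have "j div r = k \<longleftrightarrow> k \<le> j div r \<and> j div r < Suc k" by auto
    thus ?thesis
      using bounds by (simp add: less_eq_div_iff_mult_less_eq div_less_iff_less_mult add_ac)
  qed
  have col: "k * r + j < g * r" if "k < g" "j < r" for k j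
  proof -
    have "k * r + j < Suc k * r" using that by simp
    also have "\<dots> \<le> g * r" using that by (intro mult_le_mono1) auto
    finally show ?thesis .
  qed
  have row: "k * a + u < g * a" if "k < g" "u < a" for k u
  proof -
    have "k * a + u < Suc k * a" using that by simp
    also have "\<dots> \<le> g * a" using that by (intro mult_le_mono1) auto
    finally show ?thesis .
  qed

  have "MR_LRC_parity F g r h a H"
    unfolding MR_LRC_parity_def
  proof (intro conjI allI impI)
    show "H i j \<in> carrier F" if "j < g * r" for i j using H that by simp
    show "H i j = \<zero>\<^bsub>F\<^esub>" if "i < g * a" "j < g * r" "i div a \<noteq> j div r" for i j
      using H[OF that(2), of i] \<phi>_eq_0_iff that by (simp add: M_def)
    show "generates_MDS F r a (\<lambda>i j. H (k * a + i) (k * r + j))" if "k < g" for k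
      using bounds \<alpha> H col[OF that] row[OF that]
      by (intro generates_MDS_vandermonde[of a r \<alpha>]) (auto simp: M_def)
  next
    fix S assume S: "S \<subseteq> {..<g * r}" "card S = g * a + h"
      and "\<forall>k<g. a \<le> card (S \<inter> {k * r..<k * r + r})"
    moreover have "S \<inter> {k * r..<k * r + r} = {j\<in>S. j div r = k}" for k
      using div_eq by auto
    ultimately have Sk: "a \<le> card {j\<in>S. j div r = k}" if "k < g" for k using that by simp
    have finS: "finite S" using S finite_subset by blast
    have S_div: "j div r < g" "j mod r < r" if "j \<in> S" for j
      using S that bounds by (auto simp: less_mult_imp_div_less)
    show "lin_indep_family F S (g * a + h) (\<lambda>j i. H i j)"
    proof (rule lin_indep_familyI)
      show "H i j \<in> carrier F" if "j \<in> S" for i j using H S that by auto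
      fix c :: "nat \<Rightarrow> 'a"
      assume "(\<Sum>j\<in>S. c j * \<phi> (H i j)) = 0" if "i < g * a + h" for i
      moreover have "(\<Sum>j\<in>S. c j * \<phi> (H i j)) = (\<Sum>j\<in>S. c j * M i j)" for i
        using H S by (intro sum.cong) auto
      ultimately have c: "(\<Sum>j\<in>S. c j * M i j) = 0" if "i < g * a + h" for i
        using that by simp
      show "\<forall>j\<in>S. c j = 0"
      proof (rule local_moore_kernel[OF p(1,2), where G = "{..<g}" and t = t and h = h
            and grp = "\<lambda>j. j div r" and \<alpha> = "\<lambda>j. \<alpha> (j mod r)" and a = a and \<beta> = \<beta>])
        show "finite {..<g}" "min h (card {..<g}) \<le> t" "finite S"
          "card S = card {..<g} * a + h"
          using finS S by (auto simp: t_def)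
        show "(\<lambda>j. j div r) ` S \<subseteq> {..<g}" using S_div by auto
        show "\<alpha> (j mod r) \<in> frobenius_fixed q" if "j \<in> S" for j
          using \<alpha> S_div[OF that] unfolding K0_def by auto
        show "inj_on (\<lambda>j. \<alpha> (j mod r)) {j \<in> S. j div r = k}" for k
        proof (rule inj_onI)
          fix i j assume ij: "i \<in> {j \<in> S. j div r = k}" "j \<in> {j \<in> S. j div r = k}"
            and "\<alpha> (i mod r) = \<alpha> (j mod r)"
          hence "i mod r = j mod r" using S_div inj_onD[OF \<alpha>(1)] by auto
          thus "i = j" using ij by (metis (mono_tags) mem_Collect_eq div_mult_mod_eq)
        qed
        show "a \<le> card {j \<in> S. j div r = k}" if "k \<in> {..<g}" for k using Sk that by simp
        show "(\<Sum>j | j \<in> S \<and> j div r = k. c j * \<alpha> (j mod r) ^ u) = 0"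
          if k: "k \<in> {..<g}" and u: "u < a" for k u
        proof -
          have "(\<Sum>j | j \<in> S \<and> j div r = k. c j * \<alpha> (j mod r) ^ u)
              = (\<Sum>j\<in>S. if j div r = k then c j * \<alpha> (j mod r) ^ u else 0)"
            using finS by (rule sum.inter_filter)
          also have "\<dots> = (\<Sum>j\<in>S. c j * M (k * a + u) j)"
            using row[of k u] k u by (intro sum.cong) (auto simp: M_def)
          also have "\<dots> = 0" using row[of k u] k u by (intro c) auto
          finally show ?thesis .
        qed
        show "(\<Sum>j\<in>S. c j * \<beta> j ^ q ^ i) = 0" if "i < h" for i
          using c[of "g * a + i"] that by (simp add: M_def)
        \<comment> \<open>Two-level independence: grouping the relation gives coefficients
          \<open>y k\<close> in the middle field, which vanish because at most \<open>t\<close> of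
          the \<open>v k\<close> are involved. Then the \<open>w j\<close> force the entries within
          each group to vanish.\<close>
        fix d assume d: "\<And>j. j \<in> S \<Longrightarrow> d j \<in> frobenius_fixed q"
          and supp: "card ((\<lambda>j. j div r) ` {j \<in> S. d j \<noteq> 0}) \<le> t"
          and d0: "(\<Sum>j\<in>S. d j * \<beta> j) = 0"
        define T where "T = (\<lambda>j. j div r) ` {j \<in> S. d j \<noteq> 0}"
        define y where "y = (\<lambda>k. \<Sum>j | j \<in> S \<and> j div r = k. d j * w (j mod r))"
        have T: "finite T" "T \<subseteq> {..<g}" using finS S_div by (auto simp: T_def)
        have "indep_over K1 T v"
          unfolding v_def
          using b(2) T(1) inj_on_subset[OF x(1) T(2)] x(2) T(2) supp
          by (intro K1.indep_over_vandermonde) (auto simp: T_def)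
        moreover have "y \<in> T \<rightarrow> K1"
          unfolding y_def using d w S_div sub
          by (auto simp: K0_def Pi_iff subset_eq intro!: K1.sum_closed K1.mult_closed)
        moreover have "(\<Sum>k\<in>T. y k * v k) = 0"
        proof -
          have "(\<Sum>k\<in>T. y k * v k) = (\<Sum>k<g. y k * v k)"
          proof (rule sum.mono_neutral_left)
            show "\<forall>k\<in>{..<g} - T. y k * v k = 0"
              by (auto simp: y_def T_def intro!: sum.neutral)
          qed (use T in auto)
          also have "\<dots> = (\<Sum>k<g. \<Sum>j | j \<in> S \<and> j div r = k. d j * \<beta> j)"
            unfolding y_def \<beta>_def sum_distrib_right
            by (intro sum.cong refl) (auto simp: mult_ac)
          also have "\<dots> = (\<Sum>j\<in>S. d j * \<beta> j)"
            using finS S_div by (intro sum.group) auto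
          finally show ?thesis using d0 by simp
        qed
        ultimately have y0: "\<forall>k\<in>T. y k = 0" unfolding indep_over_def by blast
        show "\<forall>j\<in>S. d j = 0"
        proof (rule ccontr)
          assume "\<not> (\<forall>j\<in>S. d j = 0)"
          then obtain j0 where j0: "j0 \<in> S" "d j0 \<noteq> 0" by auto
          define k where "k = j0 div r"
          \<comment> \<open>Positions of group \<open>k\<close> outside \<open>S\<close> get
            coefficient 0, since independence of \<open>w\<close> is stated for all \<open>r\<close>
            positions.\<close>
          define d' where "d' = (\<lambda>u. if k * r + u \<in> S then d (k * r + u) else 0)"
          have "0 = y k" using y0 j0 by (auto simp: T_def k_def)
          also have "\<dots> = (\<Sum>u | u < r \<and> k * r + u \<in> S. d (k * r + u) * w u)"
            unfolding y_def
            by (rule sum.reindex_bij_witness[of _ "\<lambda>u. k * r + u" "\<lambda>j. j mod r"])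
              (use S_div in auto)
          also have "\<dots> = (\<Sum>u<r. d' u * w u)"
            by (intro sum.mono_neutral_cong_left) (auto simp: d'_def)
          finally have "(\<Sum>u<r. d' u * w u) = 0" ..
          moreover have "d' \<in> {..<r} \<rightarrow> K0" using d by (auto simp: d'_def K0_def[symmetric])
          ultimately have "d' (j0 mod r) = 0"
            using w(2) S_div[OF j0(1)] unfolding indep_over_def by blast
          thus False using j0 by (simp add: d'_def k_def)
        qed
      qed
    qed
  qed
  moreover have "finite (carrier F)" using fin(3) img inj by (metis finite_image_iff)
  moreover have "card (carrier F) = (q ^ m) ^ t" using card(3) img inj by (metis card_image)
  ultimately show ?thesis using F.field_axioms unfolding has_MR_LRC_def t_def by blast
qed

section \<open>Choice of parameters and the bound on the field size\<close>

lemma exists_power_of_two_between: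
  assumes "r \<ge> 2"
  shows "\<exists>e>0. r \<le> (2::nat) ^ e \<and> (2::nat) ^ e \<le> 2 * r"
proof -
  define e where "e = (LEAST e. r \<le> (2::nat) ^ e)"
  have "r \<le> 2 ^ r" using less_exp[of r] by simp
  hence e: "r \<le> 2 ^ e" unfolding e_def by (rule LeastI)
  have "e > 0" using e assms by (cases e) auto
  hence "2 ^ (e - 1) < r" using not_less_Least[of "e - 1" "\<lambda>e. r \<le> 2 ^ e"]
    by (simp add: e_def not_le)
  moreover have "(2::nat) ^ e = 2 * 2 ^ (e - 1)" using \<open>e > 0\<close> by (cases e) auto
  ultimately show ?thesis using e \<open>e > 0\<close> by auto
qed

text \<open>The witness is the larger of \<open>r\<close> and the least exponent with which
  \<open>q\<close> reaches \<open>g\<close>. When the latter wins, minimality bounds the overshoot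
  by one factor \<open>q\<close>.\<close>

lemma exists_extension_degree:
  fixes q r g :: nat
  assumes "2 \<le> q" "q \<le> 2 * r" "0 < g"
  shows "\<exists>m\<ge>r. g \<le> q ^ m \<and>
    real (q ^ m) \<le> max (4 * real g * (1 + ln (real g))) (real (2 * r) ^ r)"
proof (cases "g \<le> q ^ r")
  case True
  have "real (q ^ r) \<le> real (2 * r) ^ r"
    using assms power_mono[of q "2 * r" r] by (metis of_nat_le_iff of_nat_power zero_le)
  thus ?thesis using True by (intro exI[of _ r]) auto
next
  case False
  define m where "m = (LEAST m. g \<le> q ^ m)"
  \<comment> \<open>Some exponent reaches \<open>g\<close>, so the \<open>LEAST\<close> is
    attained.\<close>
  have "g \<le> 2 ^ g" using less_exp[of g] by simp
  also have "\<dots> \<le> q ^ g" using assms by (intro power_mono) auto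
  finally have m: "g \<le> q ^ m" unfolding m_def by (rule LeastI)
  have rm: "r < m"
  proof (rule ccontr)
    assume "\<not> r < m"
    hence "q ^ m \<le> q ^ r" using assms by (intro power_increasing) auto
    thus False using m False by simp
  qed
  hence "q ^ (m - 1) < g" using not_less_Least[of "m - 1" "\<lambda>m. g \<le> q ^ m"]
    by (simp add: m_def not_le)
  moreover have "q ^ m = q * q ^ (m - 1)" using rm by (cases m) auto
  ultimately have "q ^ m \<le> 2 * r * g" using assms by (simp add: mult_mono)
  hence "real (q ^ m) \<le> real (2 * r * g)" using of_nat_mono by blast
  also have "\<dots> \<le> 4 * real g * (1 + ln (real g))"
  proof -
    have "(2::nat) ^ r \<le> q ^ r" using assms by (intro power_mono) auto
    hence "real (2 ^ r) < real g" using False by (metis not_le le_less_trans of_nat_less_iff)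
    hence "ln (2 ^ r) \<le> ln (real g)" by simp
    hence "real r * ln 2 \<le> ln (real g)" by (simp add: ln_realpow)
    \<comment> \<open>The inequality ln x \<le> x - 1 at x = 1/2 gives ln 2 \<ge> 1/2.\<close>
    moreover have "real r * (1 / 2) \<le> real r * ln 2"
      using ln_le_minus_one[of "1 / 2 :: real"] by (intro mult_left_mono) (auto simp: ln_div)
    ultimately have "real r \<le> 2 * (1 + ln (real g))" by simp
    hence "real r * (2 * real g) \<le> 2 * (1 + ln (real g)) * (2 * real g)"
      by (intro mult_right_mono) auto
    thus ?thesis by (simp add: mult_ac)
  qed
  finally show ?thesis using m rm by (intro exI[of _ m]) auto
qed

theorem theorem3p13:
  shows "\<exists>(C::real) (d::nat). C > 0 \<and>
    (\<forall>a r h g :: nat. a > 0 \<longrightarrow> r > 0 \<longrightarrow> h > 0 \<longrightarrow> g > 0 \<longrightarrow> g*a + h < g*r \<longrightarrow>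
      (\<exists>F :: nat ring. field F \<and> finite (carrier F) \<and> has_MR_LRC F g r h a \<and>
         real (card (carrier F)) \<le>
           (max (C * real g * (1 + ln (real g)) ^ d) (real (2*r) ^ r)) ^ (min h g)))"
\<comment> \<open>Here \<open>g\<close> is n/r. One logarithmic factor suffices, and 4 is the
  product of the 2 in \<open>q \<le> 2 * r\<close> and the 2 in r \<le> 2 (1 + ln g).\<close>
proof (rule exI[of _ 4], rule exI[of _ 1], intro conjI allI impI)
  fix a r h g :: nat
  assume a: "a > 0" and h: "h > 0" and g: "g > 0" and lt: "g * a + h < g * r"
  have ar: "a < r" using lt by (metis add_lessD1 mult_less_cancel1)
  \<comment> \<open>From \<open>0 < a\<close> and \<open>a < r\<close> follows
    \<open>r \<ge> 2\<close>.\<close>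
  obtain e where e: "e > 0" "r \<le> (2::nat) ^ e" "(2::nat) ^ e \<le> 2 * r"
    using exists_power_of_two_between[of r] a ar by auto
  have "(2::nat) \<le> 2 ^ e" using e(1) by (cases e) auto
  then obtain m where m: "m \<ge> r" "g \<le> (2 ^ e) ^ m"
    "real ((2 ^ e) ^ m) \<le> max (4 * real g * (1 + ln (real g))) (real (2 * r) ^ r)"
    using exists_extension_degree[of "2 ^ e" r g] e g by blast
  \<comment> \<open>The closure inherits characteristic 2 from \<open>bit\<close>, so
    \<open>2 ^ e\<close> is a power of the characteristic.\<close>
  have char: "CHAR(bit alg_closure) = 2"
  proof -
    have "CHAR(bit) = 2"
      by (rule CHAR_eq_posI) (auto simp: less_Suc_eq numeral_2_eq_2)
    thus ?thesis by simp
  qed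
  obtain F :: "nat ring" where F: "field F" "finite (carrier F)"
    "card (carrier F) = ((2 ^ e) ^ m) ^ min h g" "has_MR_LRC F g r h a"
    using exists_MR_LRC[where 'a = "bit alg_closure" and q = "2 ^ e" and e = e and m = m
        and a = a and r = r and g = g and h = h] char e m a ar g h by auto
  have "real (card (carrier F)) = real ((2 ^ e) ^ m) ^ min h g"
    unfolding F(3) by (rule of_nat_power)
  also have "\<dots> \<le> (max (4 * real g * (1 + ln (real g))) (real (2 * r) ^ r)) ^ min h g"
    by (intro power_mono m(3)) auto
  finally show "\<exists>F :: nat ring. field F \<and> finite (carrier F) \<and> has_MR_LRC F g r h a \<and>
      real (card (carrier F)) \<le>
        (max (4 * real g * (1 + ln (real g)) ^ 1) (real (2*r) ^ r)) ^ (min h g)"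
    using F by auto
qed auto

end
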